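(* Let $\mathsf{X}$ be an order-enriched category with equalisers and let $\mathbb{T}=(T,m,e)$ be a Kock-Zöberlein monad on $\mathsf{X}$ such that $T$ sends regular monomorphisms to monomorphisms. Let $X$ be a split $\mathbb{T}$-algebra with $t\dashv\alpha\dashv e_X$ (where $\alpha:TX\to X$ is the algebra structure and $t:X\to TX$), and let $i:A\to X$ be an equaliser in $\mathsf{X}$ of the pair $e_X,t:X\rightrightarrows TX$. Then $X$ is algebraic if and only if $i:A\to X$ is $\mathbb{T}$-dense and $\alpha\cdot Ti:TA\to X$ is an epimorphism in $\mathsf{X}$.
   Context: An order-enriched category is a category whose hom-sets are partially ordered sets and whose composition is monotone in each variable. An adjunction $f\dashv g$ in such a category, with $f:X\to Y$ and $g:Y\to X$, means $\mathrm{id}_X\le g\cdot f$ and $f\cdot g\le \mathrm{id}_Y$. A monad $\mathbb{T}=(T,m,e)$ on an order-enriched category $\mathsf{X}$ is order-enriched if $T$ is monotone on hom-posets; it is a Kock-Zöberlein monad if moreover $Te_X\le e_{TX}$ for every object $X$. For such a monad, a morphism $\alpha:TX\to X$ is an Eilenberg-Moore algebra structure iff $\alpha\cdot e_X=\mathrm{id}_X$ iff $\alpha\dashv e_X$; hence it is unique if it exists, and one simply says that $X$ is a $\mathbb{T}$-algebra. $\mathsf{X}^{\mathbb{T}}$ is the Eilenberg-Moore category and $\mathsf{X}_{\mathbb{T}}$ the Kleisli category: its objects are those of $\mathsf{X}$, a morphism from $X$ to $Y$ in $\mathsf{X}_{\mathbb{T}}$ is a morphism $X\to TY$ of $\mathsf{X}$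 (ordered as in $\mathsf{X}$), composition is $s\circ r=m\cdot Ts\cdot r$, and the identity on $X$ is $e_X$. For $f:X\to Y$ in $\mathsf{X}$ put $f_*=e_Y\cdot f$, a Kleisli morphism from $X$ to $Y$. A $\mathbb{T}$-algebra $X$ with structure $\alpha:TX\to X$ is split if $\alpha$ has a left adjoint $t:X\to TX$ in $\mathsf{X}$. A $\mathbb{T}$-algebra is algebraic if it is isomorphic in $\mathsf{X}^{\mathbb{T}}$ to a free algebra $(TY,m_Y)$. A morphism $f:X\to Y$ of $\mathsf{X}$ is $\mathbb{T}$-dense if $f_*$ has a right adjoint $f^*$ in $\mathsf{X}_{\mathbb{T}}$. *)

theory Defs
  imports Main
begin

section \<open>Order-enriched categories\<close>

text \<open>Every arrow carries a unique domain and codomain. Composition and the order are total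
  HOL functions whose values are meaningful only on composable, respectively parallel, arrows.\<close>

record ('o, 'a) ocat =
  Obj :: "'o set"
  Arr :: "'a set"
  Dom :: "'a \<Rightarrow> 'o"
  Cod :: "'a \<Rightarrow> 'o"
  Id :: "'o \<Rightarrow> 'a"
  Comp :: "'a \<Rightarrow> 'a \<Rightarrow> 'a" (infixl "\<cdot>\<index>" 70)
  Le :: "'a \<Rightarrow> 'a \<Rightarrow> bool" (infix "\<sqsubseteq>\<index>" 50)

definition hom :: "('o, 'a) ocat \<Rightarrow> 'o \<Rightarrow> 'o \<Rightarrow> 'a set" where
  "hom C X Y = {f \<in> Arr C. Dom C f = X \<and> Cod C f = Y}"

locale category =
  fixes C :: "('o, 'a) ocat" (structure)
  assumes Dom_in_Obj: "f \<in> Arr C \<Longrightarrow> Dom C f \<in> Obj C"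
    and Cod_in_Obj: "f \<in> Arr C \<Longrightarrow> Cod C f \<in> Obj C"
    and Id_in_hom: "X \<in> Obj C \<Longrightarrow> Id C X \<in> hom C X X"
    and Comp_in_hom: "\<lbrakk>f \<in> hom C X Y; g \<in> hom C Y Z\<rbrakk> \<Longrightarrow> g \<cdot> f \<in> hom C X Z"
    and Comp_Id_right: "f \<in> hom C X Y \<Longrightarrow> f \<cdot> Id C X = f"
    and Comp_Id_left: "f \<in> hom C X Y \<Longrightarrow> Id C Y \<cdot> f = f"
    and Comp_assoc: "\<lbrakk>f \<in> hom C W X; g \<in> hom C X Y; h \<in> hom C Y Z\<rbrakk>
      \<Longrightarrow> h \<cdot> g \<cdot> f = h \<cdot> (g \<cdot> f)"

locale order_enriched_category = category +
  assumes hom_partial_order: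
      "partial_order_on (hom C X Y) {(f, g). f \<in> hom C X Y \<and> g \<in> hom C X Y \<and> f \<sqsubseteq> g}"
    and Comp_mono: "\<lbrakk>f \<in> hom C X Y; f' \<in> hom C X Y; g \<in> hom C Y Z; g' \<in> hom C Y Z;
      f \<sqsubseteq> f'; g \<sqsubseteq> g'\<rbrakk> \<Longrightarrow> g \<cdot> f \<sqsubseteq> g' \<cdot> f'"

definition monic :: "('o, 'a) ocat \<Rightarrow> 'a \<Rightarrow> bool" where
  "monic C f \<longleftrightarrow> f \<in> Arr C \<and>
    (\<forall>W. \<forall>g \<in> hom C W (Dom C f). \<forall>h \<in> hom C W (Dom C f).
      f \<cdot>\<^bsub>C\<^esub> g = f \<cdot>\<^bsub>C\<^esub> h \<longrightarrow> g = h)"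

definition epic :: "('o, 'a) ocat \<Rightarrow> 'a \<Rightarrow> bool" where
  "epic C f \<longleftrightarrow> f \<in> Arr C \<and>
    (\<forall>Z. \<forall>g \<in> hom C (Cod C f) Z. \<forall>h \<in> hom C (Cod C f) Z.
      g \<cdot>\<^bsub>C\<^esub> f = h \<cdot>\<^bsub>C\<^esub> f \<longrightarrow> g = h)"

definition isomorphic :: "('o, 'a) ocat \<Rightarrow> 'o \<Rightarrow> 'o \<Rightarrow> bool" where
  "isomorphic C X Y \<longleftrightarrow> X \<in> Obj C \<and> Y \<in> Obj C \<and>
    (\<exists>f \<in> hom C X Y. \<exists>g \<in> hom C Y X. g \<cdot>\<^bsub>C\<^esub> f = Id C X \<and> f \<cdot>\<^bsub>C\<^esub> g = Id C Y)"

text \<open>Equalisers are those of the underlying ordinary category: no order condition is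
  imposed on the factorisations.\<close>

definition equaliser :: "('o, 'a) ocat \<Rightarrow> 'o \<Rightarrow> 'o \<Rightarrow> 'a \<Rightarrow> 'a \<Rightarrow> 'o \<Rightarrow> 'a \<Rightarrow> bool" where
  "equaliser C X Y f g A i \<longleftrightarrow>
    f \<in> hom C X Y \<and> g \<in> hom C X Y \<and> i \<in> hom C A X \<and> f \<cdot>\<^bsub>C\<^esub> i = g \<cdot>\<^bsub>C\<^esub> i \<and>
    (\<forall>B. \<forall>h \<in> hom C B X. f \<cdot>\<^bsub>C\<^esub> h = g \<cdot>\<^bsub>C\<^esub> h \<longrightarrow> (\<exists>!k. k \<in> hom C B A \<and> i \<cdot>\<^bsub>C\<^esub> k = h))"

definition has_equalisers :: "('o, 'a) ocat \<Rightarrow> bool" where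
  "has_equalisers C \<longleftrightarrow>
    (\<forall>X Y. \<forall>f \<in> hom C X Y. \<forall>g \<in> hom C X Y. \<exists>A i. equaliser C X Y f g A i)"

definition regular_mono :: "('o, 'a) ocat \<Rightarrow> 'a \<Rightarrow> bool" where
  "regular_mono C i \<longleftrightarrow> (\<exists>X Y f g A. equaliser C X Y f g A i)"

text \<open>\<open>adjunction C X Y f g\<close> says that \<open>f : X \<rightarrow> Y\<close> is left adjoint to \<open>g : Y \<rightarrow> X\<close>.\<close>

definition adjunction :: "('o, 'a) ocat \<Rightarrow> 'o \<Rightarrow> 'o \<Rightarrow> 'a \<Rightarrow> 'a \<Rightarrow> bool" where
  "adjunction C X Y f g \<longleftrightarrow> f \<in> hom C X Y \<and> g \<in> hom C Y X \<and>
    Id C X \<sqsubseteq>\<^bsub>C\<^esub> g \<cdot>\<^bsub>C\<^esub> f \<and> f \<cdot>\<^bsub>C\<^esub> g \<sqsubseteq>\<^bsub>C\<^esub> Id C Y"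


section \<open>Kock-Zoeberlein monads\<close>

record ('o, 'a) monad_data =
  TObj :: "'o \<Rightarrow> 'o"
  TArr :: "'a \<Rightarrow> 'a"
  Mult :: "'o \<Rightarrow> 'a"
  Unit :: "'o \<Rightarrow> 'a"

locale monad = category C for C :: "('o, 'a) ocat" (structure) +
  fixes T :: "('o, 'a) monad_data"
  assumes TObj_in_Obj: "X \<in> Obj C \<Longrightarrow> TObj T X \<in> Obj C"
    and TArr_in_hom: "f \<in> hom C X Y \<Longrightarrow> TArr T f \<in> hom C (TObj T X) (TObj T Y)"
    and TArr_Id: "X \<in> Obj C \<Longrightarrow> TArr T (Id C X) = Id C (TObj T X)"
    and TArr_Comp: "\<lbrakk>f \<in> hom C X Y; g \<in> hom C Y Z\<rbrakk> \<Longrightarrow> TArr T (g \<cdot> f) = TArr T g \<cdot> TArr T f"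
    and Unit_in_hom: "X \<in> Obj C \<Longrightarrow> Unit T X \<in> hom C X (TObj T X)"
    and Unit_natural: "f \<in> hom C X Y \<Longrightarrow> Unit T Y \<cdot> f = TArr T f \<cdot> Unit T X"
    and Mult_in_hom: "X \<in> Obj C \<Longrightarrow> Mult T X \<in> hom C (TObj T (TObj T X)) (TObj T X)"
    and Mult_natural: "f \<in> hom C X Y \<Longrightarrow> Mult T Y \<cdot> TArr T (TArr T f) = TArr T f \<cdot> Mult T X"
    and Mult_assoc: "X \<in> Obj C \<Longrightarrow> Mult T X \<cdot> TArr T (Mult T X) = Mult T X \<cdot> Mult T (TObj T X)"
    and Mult_TArr_Unit: "X \<in> Obj C \<Longrightarrow> Mult T X \<cdot> TArr T (Unit T X) = Id C (TObj T X)"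
    and Mult_Unit: "X \<in> Obj C \<Longrightarrow> Mult T X \<cdot> Unit T (TObj T X) = Id C (TObj T X)"

locale order_enriched_monad = order_enriched_category C + monad C T
  for C :: "('o, 'a) ocat" (structure) and T :: "('o, 'a) monad_data" +
  assumes TArr_mono: "\<lbrakk>f \<in> hom C X Y; g \<in> hom C X Y; f \<sqsubseteq> g\<rbrakk> \<Longrightarrow> TArr T f \<sqsubseteq> TArr T g"

locale kz_monad = order_enriched_monad +
  assumes TArr_Unit_le: "X \<in> Obj C \<Longrightarrow> TArr T (Unit T X) \<sqsubseteq> Unit T (TObj T X)"


section \<open>Eilenberg-Moore and Kleisli categories\<close>

definition algebra :: "('o, 'a) ocat \<Rightarrow> ('o, 'a) monad_data \<Rightarrow> 'o \<times> 'a \<Rightarrow> bool" where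
  "algebra C T = (\<lambda>(X, \<alpha>). X \<in> Obj C \<and> \<alpha> \<in> hom C (TObj T X) X \<and>
    \<alpha> \<cdot>\<^bsub>C\<^esub> Unit T X = Id C X \<and> \<alpha> \<cdot>\<^bsub>C\<^esub> TArr T \<alpha> = \<alpha> \<cdot>\<^bsub>C\<^esub> Mult T X)"

text \<open>Arrows of the next two categories are tagged with their domain and codomain, which in
  general cannot be recovered from the underlying arrow of \<open>C\<close>.\<close>

definition eilenberg_moore ::
    "('o, 'a) ocat \<Rightarrow> ('o, 'a) monad_data \<Rightarrow> ('o \<times> 'a, ('o \<times> 'a) \<times> 'a \<times> ('o \<times> 'a)) ocat" where
  "eilenberg_moore C T = \<lparr>
    Obj = {P. algebra C T P},
    Arr = {((X, \<alpha>), f, (Y, \<beta>)) | X \<alpha> f Y \<beta>. algebra C T (X, \<alpha>) \<and> algebra C T (Y, \<beta>) \<and>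
      f \<in> hom C X Y \<and> f \<cdot>\<^bsub>C\<^esub> \<alpha> = \<beta> \<cdot>\<^bsub>C\<^esub> TArr T f},
    Dom = (\<lambda>(P, f, Q). P),
    Cod = (\<lambda>(P, f, Q). Q),
    Id = (\<lambda>(X, \<alpha>). ((X, \<alpha>), Id C X, (X, \<alpha>))),
    Comp = (\<lambda>(Q', g, R) (P, f, Q). (P, g \<cdot>\<^bsub>C\<^esub> f, R)),
    Le = (\<lambda>(P, f, Q) (P', g, Q'). f \<sqsubseteq>\<^bsub>C\<^esub> g)\<rparr>"

definition kleisli ::
    "('o, 'a) ocat \<Rightarrow> ('o, 'a) monad_data \<Rightarrow> ('o, 'o \<times> 'a \<times> 'o) ocat" where
  "kleisli C T = \<lparr>
    Obj = Obj C,
    Arr = {(X, r, Y) | X r Y. X \<in> Obj C \<and> Y \<in> Obj C \<and> r \<in> hom C X (TObj T Y)},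
    Dom = (\<lambda>(X, r, Y). X),
    Cod = (\<lambda>(X, r, Y). Y),
    Id = (\<lambda>X. (X, Unit T X, X)),
    Comp = (\<lambda>(Y', s, Z) (X, r, Y). (X, Mult T Z \<cdot>\<^bsub>C\<^esub> TArr T s \<cdot>\<^bsub>C\<^esub> r, Z)),
    Le = (\<lambda>(X, r, Y) (X', s, Y'). r \<sqsubseteq>\<^bsub>C\<^esub> s)\<rparr>"

definition split_algebra :: "('o, 'a) ocat \<Rightarrow> ('o, 'a) monad_data \<Rightarrow> 'o \<times> 'a \<Rightarrow> bool" where
  "split_algebra C T = (\<lambda>(X, \<alpha>). algebra C T (X, \<alpha>) \<and> (\<exists>t. adjunction C X (TObj T X) t \<alpha>))"

definition algebraic :: "('o, 'a) ocat \<Rightarrow> ('o, 'a) monad_data \<Rightarrow> 'o \<times> 'a \<Rightarrow> bool" where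
  "algebraic C T P \<longleftrightarrow> algebra C T P \<and>
    (\<exists>Y \<in> Obj C. isomorphic (eilenberg_moore C T) P (TObj T Y, Mult T Y))"

definition lower_star :: "('o, 'a) ocat \<Rightarrow> ('o, 'a) monad_data \<Rightarrow> 'a \<Rightarrow> 'o \<times> 'a \<times> 'o" where
  "lower_star C T f = (Dom C f, Unit T (Cod C f) \<cdot>\<^bsub>C\<^esub> f, Cod C f)"

definition T_dense :: "('o, 'a) ocat \<Rightarrow> ('o, 'a) monad_data \<Rightarrow> 'a \<Rightarrow> bool" where
  "T_dense C T f \<longleftrightarrow> f \<in> Arr C \<and>
    (\<exists>g. adjunction (kleisli C T) (Dom C f) (Cod C f) (lower_star C T f) g)"

end

theory Submission
  imports Defs
begin

text \<open>
  Over a Kock-Zoeberlein monad every left adjoint between algebras is a homomorphism, so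
  \<open>t \<cdot> \<alpha> = m \<cdot> T t\<close>. As \<open>i\<close> equalises \<open>e\<close> and \<open>t\<close>, this gives \<open>t \<cdot> q = T i\<close> for the
  homomorphism \<open>q = \<alpha> \<cdot> T i : T A \<rightarrow> X\<close>.

  If \<open>X\<close> is isomorphic to \<open>T Y\<close>, the unit of \<open>Y\<close> factors through \<open>i\<close> by some \<open>k : Y \<rightarrow> A\<close>, and
  \<open>T k\<close> inverts \<open>q\<close> up to the given isomorphism because \<open>T i\<close> is monic; the inverse of \<open>q\<close> is then
  the Kleisli right adjoint of \<open>i\<^sub>*\<close>. Conversely, density makes \<open>T i\<close> a left adjoint. Being
  monic it is split by its right adjoint, so \<open>q\<close> is a split monomorphism, and an epimorphism.
\<close>

section \<open>Categories: typing of arrows, split monomorphisms and epimorphisms\<close>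

context category
begin

lemma arr_if_hom:
  assumes "f \<in> hom C X Y"
  shows "f \<in> Arr C" "Dom C f = X" "Cod C f = Y"
  using assms by (simp_all add: hom_def)

lemma obj_if_hom:
  assumes "f \<in> hom C X Y"
  shows "X \<in> Obj C" "Y \<in> Obj C"
  using assms Dom_in_Obj Cod_in_Obj by (auto simp: hom_def)

text \<open>With typing phrased through \<open>Dom\<close> and \<open>Cod\<close> the simplifier can discharge the side
  conditions, as no object has to be guessed.\<close>

lemma arr_Comp:
  assumes "f \<in> Arr C" "g \<in> Arr C" "Cod C f = Dom C g"
  shows "g \<cdot> f \<in> Arr C" "Dom C (g \<cdot> f) = Dom C f" "Cod C (g \<cdot> f) = Cod C g"
  using Comp_in_hom[of f "Dom C f" "Cod C f" g "Cod C g"] assms by (simp_all add: hom_def)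

lemma Comp_assoc_arr:
  assumes "f \<in> Arr C" "g \<in> Arr C" "h \<in> Arr C" "Cod C f = Dom C g" "Cod C g = Dom C h"
  shows "h \<cdot> g \<cdot> f = h \<cdot> (g \<cdot> f)"
  using assms Comp_assoc by (simp add: hom_def)

lemma arr_Id:
  assumes "X \<in> Obj C"
  shows "Id C X \<in> Arr C" "Dom C (Id C X) = X" "Cod C (Id C X) = X"
  using Id_in_hom[OF assms] by (simp_all add: hom_def)

lemma Comp_Id_arr:
  assumes "f \<in> Arr C"
  shows "Dom C f = X \<Longrightarrow> f \<cdot> Id C X = f" "Cod C f = X \<Longrightarrow> Id C X \<cdot> f = f"
  using assms Comp_Id_left Comp_Id_right by (auto simp: hom_def)

lemmas arr_simps = arr_Comp Comp_assoc_arr arr_Id Comp_Id_arr Dom_in_Obj Cod_in_Obj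

text \<open>Since \<open>q \<cdot> r \<cdot> q = q\<close>, the epimorphism \<open>q\<close> can be
  cancelled on the right.\<close>

lemma iso_if_split_mono_epic:
  assumes "q \<in> hom C X Y" "r \<in> hom C Y X" "r \<cdot> q = Id C X" "epic C q"
  shows "q \<cdot> r = Id C Y"
proof -
  have "q \<cdot> r \<cdot> q = Id C Y \<cdot> q"
    using assms(3) arr_if_hom[OF assms(1)] arr_if_hom[OF assms(2)]
    by (simp add: arr_simps obj_if_hom[OF assms(1)])
  moreover have "q \<cdot> r \<in> hom C Y Y" "Id C Y \<in> hom C Y Y"
    using assms(1,2) Comp_in_hom Id_in_hom obj_if_hom by blast+
  ultimately show ?thesis
    using assms(1,4) by (simp add: epic_def hom_def)
qed

lemma epic_if_right_inverse:
  assumes q: "q \<in> hom C X Y" and p: "p \<in> hom C Y X" and qp: "q \<cdot> p = Id C Y"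
  shows "epic C q"
  unfolding epic_def
proof (intro conjI allI ballI impI)
  fix Z g h
  assume "g \<in> hom C (Cod C q) Z" "h \<in> hom C (Cod C q) Z" and eq: "g \<cdot> q = h \<cdot> q"
  then have g: "g \<in> hom C Y Z" and h: "h \<in> hom C Y Z"
    using arr_if_hom[OF q] by simp_all
  have "g \<cdot> (q \<cdot> p) = h \<cdot> (q \<cdot> p)"
    using eq by (simp flip: Comp_assoc[OF p q g] Comp_assoc[OF p q h])
  then show "g = h"
    using g h by (simp add: qp Comp_Id_right)
qed (rule arr_if_hom[OF q])

end

section \<open>Order-enriched categories: adjunctions between arrows\<close>

context order_enriched_category
begin

lemma Le_refl: "f \<in> hom C X Y \<Longrightarrow> f \<sqsubseteq> f"
  using hom_partial_order[of X Y] by (auto simp: partial_order_on_def preorder_on_def refl_on_def)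

lemma Le_trans:
  assumes "f \<in> hom C X Y" "g \<in> hom C X Y" "h \<in> hom C X Y" "f \<sqsubseteq> g" "g \<sqsubseteq> h"
  shows "f \<sqsubseteq> h"
  using hom_partial_order[of X Y] assms
  unfolding partial_order_on_def preorder_on_def trans_def by blast

lemma Le_antisym:
  assumes "f \<in> hom C X Y" "g \<in> hom C X Y" "f \<sqsubseteq> g" "g \<sqsubseteq> f"
  shows "f = g"
  using hom_partial_order[of X Y] assms
  unfolding partial_order_on_def antisym_def by blast

lemma Comp_mono_left:
  assumes "f \<in> hom C X Y" "g \<in> hom C Y Z" "g' \<in> hom C Y Z" "g \<sqsubseteq> g'"
  shows "g \<cdot> f \<sqsubseteq> g' \<cdot> f"
  using assms Comp_mono Le_refl by blast

lemma Comp_mono_right: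
  assumes "f \<in> hom C X Y" "f' \<in> hom C X Y" "g \<in> hom C Y Z" "f \<sqsubseteq> f'"
  shows "g \<cdot> f \<sqsubseteq> g \<cdot> f'"
  using assms Comp_mono Le_refl by blast

text \<open>Composing the unit and the counit with \<open>f\<close> gives the two inequalities, so
  antisymmetry makes the triangle identity automatic.\<close>

lemma left_adjoint_right_adjoint_left_adjoint:
  assumes "adjunction C X Y f g"
  shows "f \<cdot> g \<cdot> f = f"
proof -
  have f: "f \<in> hom C X Y" and g: "g \<in> hom C Y X"
    and unit: "Id C X \<sqsubseteq> g \<cdot> f" and counit: "f \<cdot> g \<sqsubseteq> Id C Y"
    using assms by (auto simp: adjunction_def)
  have gf: "g \<cdot> f \<in> hom C X X" and fg: "f \<cdot> g \<in> hom C Y Y"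
    using Comp_in_hom f g by blast+
  have "f \<cdot> Id C X \<sqsubseteq> f \<cdot> (g \<cdot> f)"
    using Comp_mono_right[OF Id_in_hom gf f unit] obj_if_hom[OF f] by simp
  moreover have "f \<cdot> g \<cdot> f \<sqsubseteq> Id C Y \<cdot> f"
    using Comp_mono_left[OF f fg Id_in_hom counit] obj_if_hom[OF f] by simp
  ultimately have "f \<sqsubseteq> f \<cdot> g \<cdot> f" "f \<cdot> g \<cdot> f \<sqsubseteq> f"
    using f g by (simp_all add: Comp_Id_left Comp_Id_right Comp_assoc)
  then show ?thesis
    using Le_antisym Comp_in_hom[OF f fg] f by blast
qed

text \<open>The unit of \<open>f'\<close> and the counit of \<open>f\<close> give
  \<open>f \<sqsubseteq> f \<cdot> g \<cdot> f' \<sqsubseteq> f'\<close>. By symmetry a right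
  adjoint determines its left adjoint.\<close>

lemma left_adjoint_le:
  assumes "adjunction C X Y f g" "adjunction C X Y f' g"
  shows "f \<sqsubseteq> f'"
proof -
  have f: "f \<in> hom C X Y" and f': "f' \<in> hom C X Y" and g: "g \<in> hom C Y X"
    and unit: "Id C X \<sqsubseteq> g \<cdot> f'" and counit: "f \<cdot> g \<sqsubseteq> Id C Y"
    using assms by (auto simp: adjunction_def)
  have X: "X \<in> Obj C" "Y \<in> Obj C"
    using obj_if_hom[OF f] .
  have "f \<sqsubseteq> f \<cdot> (g \<cdot> f')"
    using Comp_mono_right[OF Id_in_hom[OF X(1)] Comp_in_hom[OF f' g] f unit] f
    by (simp add: Comp_Id_right)
  moreover have "f \<cdot> (g \<cdot> f') \<sqsubseteq> f'"
    using Comp_mono_left[OF f' Comp_in_hom[OF g f] Id_in_hom[OF X(2)] counit]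
    by (simp add: Comp_Id_left[OF f'] Comp_assoc[OF f' g f])
  ultimately show ?thesis
    using Le_trans[OF f Comp_in_hom[OF Comp_in_hom[OF f' g] f] f'] by blast
qed

lemma left_adjoint_unique:
  assumes "adjunction C X Y f g" "adjunction C X Y f' g"
  shows "f = f'"
  using assms left_adjoint_le Le_antisym unfolding adjunction_def by metis

end

section \<open>Monads: isomorphisms of algebras and density\<close>

context monad
begin

lemma arr_TArr:
  assumes "f \<in> Arr C"
  shows "TArr T f \<in> Arr C" "Dom C (TArr T f) = TObj T (Dom C f)" "Cod C (TArr T f) = TObj T (Cod C f)"
  using TArr_in_hom[of f "Dom C f" "Cod C f"] assms by (simp_all add: hom_def)

lemma arr_Unit:
  assumes "X \<in> Obj C"
  shows "Unit T X \<in> Arr C" "Dom C (Unit T X) = X" "Cod C (Unit T X) = TObj T X"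
  using Unit_in_hom[OF assms] by (simp_all add: hom_def)

lemma arr_Mult:
  assumes "X \<in> Obj C"
  shows "Mult T X \<in> Arr C" "Dom C (Mult T X) = TObj T (TObj T X)" "Cod C (Mult T X) = TObj T X"
  using Mult_in_hom[OF assms] by (simp_all add: hom_def)

lemma TArr_Comp_arr:
  assumes "f \<in> Arr C" "g \<in> Arr C" "Cod C f = Dom C g"
  shows "TArr T (g \<cdot> f) = TArr T g \<cdot> TArr T f"
  using assms TArr_Comp by (simp add: hom_def)

lemmas monad_simps = arr_simps arr_TArr arr_Unit arr_Mult TArr_Comp_arr TObj_in_Obj

lemma algebra_free:
  assumes "Y \<in> Obj C"
  shows "algebra C T (TObj T Y, Mult T Y)"
  using assms by (simp add: algebra_def TObj_in_Obj Mult_in_hom Mult_Unit Mult_assoc)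

lemma in_hom_eilenberg_moore:
  "F \<in> hom (eilenberg_moore C T) (X, \<alpha>) (Y, \<beta>) \<longleftrightarrow>
    (\<exists>f. F = ((X, \<alpha>), f, (Y, \<beta>)) \<and> algebra C T (X, \<alpha>) \<and> algebra C T (Y, \<beta>) \<and>
      f \<in> hom C X Y \<and> f \<cdot> \<alpha> = \<beta> \<cdot> TArr T f)"
  unfolding hom_def[of "eilenberg_moore C T"] by (auto simp: eilenberg_moore_def)

text \<open>The inverse of a homomorphism is a homomorphism, so compatibility with the structures is
  asked of \<open>g\<close> only: inserting \<open>T (g \<cdot> f) = id\<close> to the right of
  \<open>\<alpha>\<close> turns \<open>f \<cdot> \<alpha>\<close> into
  \<open>f \<cdot> g \<cdot> \<beta> \<cdot> T f\<close>.\<close>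

lemma algebra_isomorphicI:
  assumes P: "algebra C T (X, \<alpha>)" and Q: "algebra C T (Y, \<beta>)"
    and f: "f \<in> hom C X Y" and g: "g \<in> hom C Y X"
    and gf: "g \<cdot> f = Id C X" and fg: "f \<cdot> g = Id C Y"
    and g_alg: "g \<cdot> \<beta> = \<alpha> \<cdot> TArr T g"
  shows "isomorphic (eilenberg_moore C T) (X, \<alpha>) (Y, \<beta>)"
proof -
  have \<alpha>: "\<alpha> \<in> hom C (TObj T X) X" and \<beta>: "\<beta> \<in> hom C (TObj T Y) Y"
    using P Q by (auto simp: algebra_def)
  note simps = monad_simps arr_if_hom[OF \<alpha>] arr_if_hom[OF \<beta>] arr_if_hom[OF f] arr_if_hom[OF g]
    obj_if_hom[OF f]
  have "f \<cdot> \<alpha> = f \<cdot> (\<alpha> \<cdot> TArr T (g \<cdot> f))"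
    using gf by (simp add: simps TArr_Id)
  also have "\<dots> = f \<cdot> (\<alpha> \<cdot> TArr T g \<cdot> TArr T f)"
    by (simp add: simps)
  also have "\<dots> = f \<cdot> g \<cdot> (\<beta> \<cdot> TArr T f)"
    unfolding g_alg[symmetric] by (simp add: simps)
  also have "\<dots> = \<beta> \<cdot> TArr T f"
    unfolding fg by (simp add: simps)
  finally have f_alg: "f \<cdot> \<alpha> = \<beta> \<cdot> TArr T f" .
  show ?thesis
    unfolding isomorphic_def
  proof (intro conjI bexI)
    show "((X, \<alpha>), f, (Y, \<beta>)) \<in> hom (eilenberg_moore C T) (X, \<alpha>) (Y, \<beta>)"
      "((Y, \<beta>), g, (X, \<alpha>)) \<in> hom (eilenberg_moore C T) (Y, \<beta>) (X, \<alpha>)"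
      using P Q f g f_alg g_alg by (simp_all add: in_hom_eilenberg_moore)
  qed (use P Q gf fg in \<open>simp_all add: eilenberg_moore_def\<close>)
qed

lemma algebra_isomorphicE:
  assumes "isomorphic (eilenberg_moore C T) (X, \<alpha>) (Y, \<beta>)"
  obtains f g where "f \<in> hom C X Y" "g \<in> hom C Y X" "g \<cdot> f = Id C X" "f \<cdot> g = Id C Y"
    "f \<cdot> \<alpha> = \<beta> \<cdot> TArr T f" "g \<cdot> \<beta> = \<alpha> \<cdot> TArr T g"
proof -
  obtain F G where "F \<in> hom (eilenberg_moore C T) (X, \<alpha>) (Y, \<beta>)"
    "G \<in> hom (eilenberg_moore C T) (Y, \<beta>) (X, \<alpha>)"
    and eqs: "G \<cdot>\<^bsub>eilenberg_moore C T\<^esub> F = Id (eilenberg_moore C T) (X, \<alpha>)"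
      "F \<cdot>\<^bsub>eilenberg_moore C T\<^esub> G = Id (eilenberg_moore C T) (Y, \<beta>)"
    using assms unfolding isomorphic_def by blast
  then obtain f g where "F = ((X, \<alpha>), f, (Y, \<beta>))" "G = ((Y, \<beta>), g, (X, \<alpha>))"
    "f \<in> hom C X Y" "g \<in> hom C Y X" "f \<cdot> \<alpha> = \<beta> \<cdot> TArr T f" "g \<cdot> \<beta> = \<alpha> \<cdot> TArr T g"
    unfolding in_hom_eilenberg_moore by blast
  with eqs show thesis
    by (intro that) (simp_all add: eilenberg_moore_def)
qed

text \<open>By naturality of the unit and the unit laws, the Kleisli composites of \<open>s\<close>
  and \<open>i\<^sub>*\<close> collapse to \<open>s \<cdot> i\<close> and
  \<open>T i \<cdot> s\<close>, so density can be tested in \<open>C\<close> itself.\<close>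

lemma T_dense_iff:
  assumes i: "i \<in> hom C A X"
  shows "T_dense C T i \<longleftrightarrow> (\<exists>s \<in> hom C X (TObj T A).
    Unit T A \<sqsubseteq> s \<cdot> i \<and> TArr T i \<cdot> s \<sqsubseteq> Unit T X)"
proof -
  note simps = monad_simps arr_if_hom[OF i] obj_if_hom[OF i]
  have unit: "Mult T A \<cdot> TArr T s \<cdot> (Unit T X \<cdot> i) = s \<cdot> i"
    and counit: "Mult T X \<cdot> TArr T (Unit T X \<cdot> i) \<cdot> s = TArr T i \<cdot> s"
    if s: "s \<in> hom C X (TObj T A)" for s
  proof -
    note simps = simps arr_if_hom[OF s]
    have "Mult T A \<cdot> TArr T s \<cdot> (Unit T X \<cdot> i) = Mult T A \<cdot> (TArr T s \<cdot> Unit T X) \<cdot> i"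
      by (simp add: simps)
    also have "\<dots> = Mult T A \<cdot> Unit T (TObj T A) \<cdot> (s \<cdot> i)"
      unfolding Unit_natural[OF s, symmetric] by (simp add: simps)
    finally show "Mult T A \<cdot> TArr T s \<cdot> (Unit T X \<cdot> i) = s \<cdot> i"
      by (simp add: simps Mult_Unit)
    have "Mult T X \<cdot> TArr T (Unit T X \<cdot> i) \<cdot> s = Mult T X \<cdot> TArr T (Unit T X) \<cdot> (TArr T i \<cdot> s)"
      by (simp add: simps)
    then show "Mult T X \<cdot> TArr T (Unit T X \<cdot> i) \<cdot> s = TArr T i \<cdot> s"
      by (simp add: simps Mult_TArr_Unit)
  qed
  have lower: "Unit T X \<cdot> i \<in> hom C A (TObj T X)"
    using i Comp_in_hom Unit_in_hom obj_if_hom by blast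
  \<comment> \<open>\<open>hom_def\<close> is instantiated at a record literal so that only the
    Kleisli hom-sets unfold, while \<open>hom C\<close> stays folded.\<close>
  have "adjunction (kleisli C T) A X (lower_star C T i) g \<longleftrightarrow>
      (\<exists>s. g = (X, s, A) \<and> s \<in> hom C X (TObj T A) \<and>
        Unit T A \<sqsubseteq> s \<cdot> i \<and> TArr T i \<cdot> s \<sqsubseteq> Unit T X)" for g
    using lower obj_if_hom[OF i] unit counit
    by (cases g) (auto simp: adjunction_def kleisli_def lower_star_def arr_if_hom[OF i]
        hom_def[of "\<lparr>Obj = _, Arr = _, Dom = _, Cod = _, Id = _, Comp = _, Le = _\<rparr>"])
  then show ?thesis
    unfolding T_dense_def using arr_if_hom[OF i] by auto
qed

end

section \<open>Kock-Zoeberlein monads: lax homomorphisms and left adjoints\<close>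

context kz_monad
begin

text \<open>Composing \<open>TArr_Unit_le\<close> with \<open>T \<alpha>\<close> yields
  \<open>T (\<alpha> \<cdot> e) = id\<close> on the left and, by naturality,
  \<open>e \<cdot> \<alpha>\<close> on the right. This is the unit of the adjunction in which
  \<open>\<alpha>\<close> is left adjoint to \<open>e\<close>.\<close>

lemma id_le_Unit_algebra:
  assumes "algebra C T (X, \<alpha>)"
  shows "Id C (TObj T X) \<sqsubseteq> Unit T X \<cdot> \<alpha>"
proof -
  have X: "X \<in> Obj C" and \<alpha>: "\<alpha> \<in> hom C (TObj T X) X" and \<alpha>e: "\<alpha> \<cdot> Unit T X = Id C X"
    using assms by (auto simp: algebra_def)
  note simps = monad_simps X arr_if_hom[OF \<alpha>]
  have "TArr T \<alpha> \<cdot> TArr T (Unit T X) \<sqsubseteq> TArr T \<alpha> \<cdot> Unit T (TObj T X)"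
    by (rule Comp_mono_right[OF _ _ TArr_in_hom[OF \<alpha>] TArr_Unit_le[OF X]])
      (simp_all add: hom_def simps)
  moreover have "TArr T \<alpha> \<cdot> TArr T (Unit T X) = Id C (TObj T X)"
    using \<alpha>e X by (simp add: TArr_Id TArr_Comp[OF Unit_in_hom[OF X] \<alpha>, symmetric])
  ultimately show ?thesis
    by (simp add: Unit_natural[OF \<alpha>])
qed

text \<open>The counit making \<open>T e\<close> left adjoint to \<open>m\<close>: apply
  \<open>T\<close> to \<open>TArr_Unit_le\<close> and compose with \<open>m\<close>; naturality of
  \<open>m\<close> and a unit law simplify the two sides.\<close>

lemma TArr_Unit_Mult_le:
  assumes Y: "Y \<in> Obj C"
  shows "TArr T (Unit T Y) \<cdot> Mult T Y \<sqsubseteq> Id C (TObj T (TObj T Y))"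
proof -
  note simps = monad_simps Y
  have "TArr T (TArr T (Unit T Y)) \<sqsubseteq> TArr T (Unit T (TObj T Y))"
    by (rule TArr_mono[OF _ _ TArr_Unit_le[OF Y]]) (simp_all add: hom_def simps)
  then have "Mult T (TObj T Y) \<cdot> TArr T (TArr T (Unit T Y)) \<sqsubseteq>
      Mult T (TObj T Y) \<cdot> TArr T (Unit T (TObj T Y))"
    by (intro Comp_mono_right[OF _ _ Mult_in_hom]) (simp_all add: hom_def simps)
  then show ?thesis
    by (simp add: Mult_natural[OF Unit_in_hom[OF Y]] Mult_TArr_Unit TObj_in_Obj Y)
qed

text \<open>Inserting \<open>id \<sqsubseteq> e \<cdot> \<alpha>\<close> gives \<open>\<beta>
  \<cdot> T f \<sqsubseteq> \<beta> \<cdot> T f \<cdot> e \<cdot> \<alpha>\<close>, and naturality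
  of \<open>e\<close> reduces the right side to \<open>\<beta> \<cdot> e \<cdot> f \<cdot> \<alpha>
  = f \<cdot> \<alpha>\<close>.\<close>

lemma algebra_lax_hom:
  assumes P: "algebra C T (X, \<alpha>)" and Q: "algebra C T (Y, \<beta>)" and f: "f \<in> hom C X Y"
  shows "\<beta> \<cdot> TArr T f \<sqsubseteq> f \<cdot> \<alpha>"
proof -
  have X: "X \<in> Obj C" "Y \<in> Obj C" and \<alpha>: "\<alpha> \<in> hom C (TObj T X) X"
    and \<beta>: "\<beta> \<in> hom C (TObj T Y) Y" and \<beta>e: "\<beta> \<cdot> Unit T Y = Id C Y"
    using P Q by (auto simp: algebra_def)
  note simps = monad_simps X arr_if_hom[OF \<alpha>] arr_if_hom[OF \<beta>] arr_if_hom[OF f]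
  have "\<beta> \<cdot> TArr T f \<cdot> Id C (TObj T X) \<sqsubseteq> \<beta> \<cdot> TArr T f \<cdot> (Unit T X \<cdot> \<alpha>)"
    by (rule Comp_mono_right[where X = "TObj T X" and Y = "TObj T X" and Z = Y, OF _ _ _ id_le_Unit_algebra[OF P]])
      (simp_all add: hom_def simps)
  moreover have "\<beta> \<cdot> TArr T f \<cdot> (Unit T X \<cdot> \<alpha>) = \<beta> \<cdot> (TArr T f \<cdot> Unit T X) \<cdot> \<alpha>"
    by (simp add: simps)
  moreover have "\<dots> = \<beta> \<cdot> Unit T Y \<cdot> (f \<cdot> \<alpha>)"
    unfolding Unit_natural[OF f, symmetric] by (simp add: simps)
  ultimately show ?thesis
    by (simp add: simps \<beta>e)
qed

text \<open>Laxness of \<open>f\<close> is one inequality. The other is the mate of the laxness of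
  \<open>g\<close>: \<open>f \<cdot> \<alpha> \<sqsubseteq> f \<cdot> \<alpha> \<cdot> T g \<cdot> T
  f \<sqsubseteq> f \<cdot> g \<cdot> \<beta> \<cdot> T f \<sqsubseteq> \<beta> \<cdot> T
  f\<close>.\<close>

lemma left_adjoint_algebra_hom:
  assumes P: "algebra C T (X, \<alpha>)" and Q: "algebra C T (Y, \<beta>)" and adj: "adjunction C X Y f g"
  shows "f \<cdot> \<alpha> = \<beta> \<cdot> TArr T f"
proof -
  have X: "X \<in> Obj C" "Y \<in> Obj C" and \<alpha>: "\<alpha> \<in> hom C (TObj T X) X"
    and \<beta>: "\<beta> \<in> hom C (TObj T Y) Y"
    using P Q by (auto simp: algebra_def)
  have f: "f \<in> hom C X Y" and g: "g \<in> hom C Y X"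
    and unit: "Id C X \<sqsubseteq> g \<cdot> f" and counit: "f \<cdot> g \<sqsubseteq> Id C Y"
    using adj by (auto simp: adjunction_def)
  note simps = monad_simps X arr_if_hom[OF \<alpha>] arr_if_hom[OF \<beta>] arr_if_hom[OF f] arr_if_hom[OF g]
  note typing = hom_def simps
  have "TArr T (Id C X) \<sqsubseteq> TArr T (g \<cdot> f)"
    by (rule TArr_mono[where X = X and Y = X]) (simp_all add: typing unit)
  then have "f \<cdot> \<alpha> \<cdot> TArr T (Id C X) \<sqsubseteq> f \<cdot> \<alpha> \<cdot> TArr T (g \<cdot> f)"
    by (intro Comp_mono_right[where X = "TObj T X" and Y = "TObj T X" and Z = Y])
      (simp_all add: typing)
  then have 1: "f \<cdot> \<alpha> \<sqsubseteq> f \<cdot> (\<alpha> \<cdot> TArr T g) \<cdot> TArr T f"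
    by (simp add: simps TArr_Id)
  have "f \<cdot> (\<alpha> \<cdot> TArr T g) \<sqsubseteq> f \<cdot> (g \<cdot> \<beta>)"
    by (rule Comp_mono_right[where X = "TObj T Y" and Y = X and Z = Y])
      (simp_all add: typing algebra_lax_hom[OF Q P g])
  then have 2: "f \<cdot> (\<alpha> \<cdot> TArr T g) \<cdot> TArr T f \<sqsubseteq> f \<cdot> (g \<cdot> \<beta>) \<cdot> TArr T f"
    by (intro Comp_mono_left[where X = "TObj T X" and Y = "TObj T Y" and Z = Y])
      (simp_all add: typing)
  have "f \<cdot> g \<cdot> (\<beta> \<cdot> TArr T f) \<sqsubseteq> Id C Y \<cdot> (\<beta> \<cdot> TArr T f)"
    by (rule Comp_mono_left[where X = "TObj T X" and Y = Y and Z = Y])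
      (simp_all add: typing counit)
  then have 3: "f \<cdot> (g \<cdot> \<beta>) \<cdot> TArr T f \<sqsubseteq> \<beta> \<cdot> TArr T f"
    by (simp add: simps)
  have h: "f \<cdot> \<alpha> \<in> hom C (TObj T X) Y" "\<beta> \<cdot> TArr T f \<in> hom C (TObj T X) Y"
    "f \<cdot> (\<alpha> \<cdot> TArr T g) \<cdot> TArr T f \<in> hom C (TObj T X) Y"
    "f \<cdot> (g \<cdot> \<beta>) \<cdot> TArr T f \<in> hom C (TObj T X) Y"
    by (simp_all add: typing)
  have "f \<cdot> \<alpha> \<sqsubseteq> \<beta> \<cdot> TArr T f"
    using 1 2 3 h Le_trans by meson
  then show ?thesis
    using Le_antisym h algebra_lax_hom[OF P Q f] by blast
qed

text \<open>The Kleisli right adjoint of \<open>i\<^sub>*\<close> extends to a homomorphism that is right adjoint to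
  \<open>T i\<close> in \<open>C\<close>.\<close>
lemma T_dense_imp_adjunction:
  assumes i: "i \<in> hom C A X" and "T_dense C T i"
  obtains r where "adjunction C (TObj T A) (TObj T X) (TArr T i) r"
proof -
  obtain s where s: "s \<in> hom C X (TObj T A)"
    and unit: "Unit T A \<sqsubseteq> s \<cdot> i" and counit: "TArr T i \<cdot> s \<sqsubseteq> Unit T X"
    using assms by (auto simp: T_dense_iff)
  note simps = monad_simps arr_if_hom[OF i] arr_if_hom[OF s] obj_if_hom[OF i]
  note typing = hom_def simps
  \<comment> \<open>The right adjoint is the homomorphic extension \<open>m \<cdot> T s\<close> of
    \<open>s\<close>; unit and counit arise by applying \<open>T\<close> to those of
    \<open>s\<close> and composing with \<open>m\<close>.\<close>
  have "TArr T (Unit T A) \<sqsubseteq> TArr T (s \<cdot> i)"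
    by (rule TArr_mono[where X = A and Y = "TObj T A"]) (simp_all add: typing unit)
  then have "Mult T A \<cdot> TArr T (Unit T A) \<sqsubseteq> Mult T A \<cdot> TArr T (s \<cdot> i)"
    by (intro Comp_mono_right[where X = "TObj T A" and Y = "TObj T (TObj T A)" and Z = "TObj T A"])
      (simp_all add: typing)
  then have 1: "Id C (TObj T A) \<sqsubseteq> Mult T A \<cdot> TArr T s \<cdot> TArr T i"
    by (simp add: simps Mult_TArr_Unit)
  have "TArr T (TArr T i \<cdot> s) \<sqsubseteq> TArr T (Unit T X)"
    by (rule TArr_mono[where X = X and Y = "TObj T X"]) (simp_all add: typing counit)
  then have "Mult T X \<cdot> TArr T (TArr T i \<cdot> s) \<sqsubseteq> Mult T X \<cdot> TArr T (Unit T X)"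
    by (intro Comp_mono_right[where X = "TObj T X" and Y = "TObj T (TObj T X)" and Z = "TObj T X"])
      (simp_all add: typing)
  moreover have "Mult T X \<cdot> TArr T (TArr T i \<cdot> s) = TArr T i \<cdot> (Mult T A \<cdot> TArr T s)"
  proof -
    have "Mult T X \<cdot> TArr T (TArr T i \<cdot> s) = Mult T X \<cdot> TArr T (TArr T i) \<cdot> TArr T s"
      by (simp add: simps)
    then show ?thesis
      unfolding Mult_natural[OF i] by (simp add: simps)
  qed
  ultimately have 2: "TArr T i \<cdot> (Mult T A \<cdot> TArr T s) \<sqsubseteq> Id C (TObj T X)"
    by (simp add: simps Mult_TArr_Unit)
  have "adjunction C (TObj T A) (TObj T X) (TArr T i) (Mult T A \<cdot> TArr T s)"
    using 1 2 by (simp add: adjunction_def typing)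
  then show thesis
    by (rule that)
qed

end

section \<open>Split algebras and the comparison homomorphism from \<open>T A\<close>\<close>

text \<open>\<open>monic_TArr\<close> is the instance at the regular monomorphism \<open>i\<close>
  of the assumption on \<open>T\<close>.\<close>

locale split_algebra_equaliser = kz_monad +
  fixes X A \<alpha> t i
  assumes algebra: "algebra C T (X, \<alpha>)"
    and t_adjunction: "adjunction C X (TObj T X) t \<alpha>"
    and equaliser: "equaliser C X (TObj T X) (Unit T X) t A i"
    and monic_TArr: "monic C (TArr T i)"
begin

lemma X_in_Obj: "X \<in> Obj C"
  and \<alpha>_in_hom: "\<alpha> \<in> hom C (TObj T X) X"
  and \<alpha>_Unit: "\<alpha> \<cdot> Unit T X = Id C X"
  and \<alpha>_TArr_\<alpha>: "\<alpha> \<cdot> TArr T \<alpha> = \<alpha> \<cdot> Mult T X"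
  using algebra by (auto simp: algebra_def)

lemma t_in_hom: "t \<in> hom C X (TObj T X)"
  and t_\<alpha>_le: "t \<cdot> \<alpha> \<sqsubseteq> Id C (TObj T X)"
  using t_adjunction by (auto simp: adjunction_def)

lemma i_in_hom: "i \<in> hom C A X"
  and Unit_i: "Unit T X \<cdot> i = t \<cdot> i"
  using equaliser by (auto simp: equaliser_def)

lemmas split_simps = monad_simps X_in_Obj arr_if_hom[OF \<alpha>_in_hom] arr_if_hom[OF t_in_hom]
  arr_if_hom[OF i_in_hom] obj_if_hom(1)[OF i_in_hom]

text \<open>Compose the counit \<open>t \<cdot> \<alpha> \<sqsubseteq> id\<close> with
  \<open>e\<close>, a section of \<open>\<alpha>\<close>. It later serves as the counit witnessing
  density.\<close>

lemma t_le_Unit: "t \<sqsubseteq> Unit T X"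
proof -
  have "t \<cdot> \<alpha> \<cdot> Unit T X \<sqsubseteq> Id C (TObj T X) \<cdot> Unit T X"
    by (rule Comp_mono_left[OF Unit_in_hom[OF X_in_Obj] _ Id_in_hom t_\<alpha>_le])
      (simp_all add: hom_def split_simps)
  then show ?thesis
    by (simp add: split_simps \<alpha>_Unit)
qed

lemma t_comparison: "t \<cdot> (\<alpha> \<cdot> TArr T i) = TArr T i"
proof -
  have "t \<cdot> (\<alpha> \<cdot> TArr T i) = t \<cdot> \<alpha> \<cdot> TArr T i"
    by (simp add: split_simps)
  also have "\<dots> = Mult T X \<cdot> TArr T (t \<cdot> i)"
    unfolding left_adjoint_algebra_hom[OF algebra algebra_free[OF X_in_Obj] t_adjunction]
    by (simp add: split_simps)
  also have "\<dots> = Mult T X \<cdot> TArr T (Unit T X) \<cdot> TArr T i"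
    unfolding Unit_i[symmetric] by (simp add: split_simps)
  finally show ?thesis
    by (simp add: split_simps Mult_TArr_Unit)
qed

text \<open>Naturality of \<open>m\<close> at \<open>i\<close> followed by associativity of
  \<open>\<alpha>\<close>: the comparison is a homomorphism from the free algebra on
  \<open>A\<close>.\<close>

lemma comparison_algebra_hom:
  "\<alpha> \<cdot> TArr T i \<cdot> Mult T A = \<alpha> \<cdot> TArr T (\<alpha> \<cdot> TArr T i)"
proof -
  have "\<alpha> \<cdot> TArr T i \<cdot> Mult T A = \<alpha> \<cdot> Mult T X \<cdot> TArr T (TArr T i)"
    using Mult_natural[OF i_in_hom] by (simp add: split_simps)
  then show ?thesis
    unfolding \<alpha>_TArr_\<alpha>[symmetric] by (simp add: split_simps)
qed

lemma algebraic_if_dense_epic: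
  assumes "T_dense C T i" "epic C (\<alpha> \<cdot> TArr T i)"
  shows "algebraic C T (X, \<alpha>)"
proof -
  obtain r where adj: "adjunction C (TObj T A) (TObj T X) (TArr T i) r"
    using T_dense_imp_adjunction[OF i_in_hom assms(1)] .
  have r: "r \<in> hom C (TObj T X) (TObj T A)"
    using adj by (simp add: adjunction_def)
  note simps = split_simps arr_if_hom[OF r]
  \<comment> \<open>The triangle identity is put in a form from which the monomorphism
    \<open>T i\<close> can be cancelled.\<close>
  have "TArr T i \<cdot> (r \<cdot> TArr T i) = TArr T i \<cdot> Id C (TObj T A)"
    using left_adjoint_right_adjoint_left_adjoint[OF adj] by (simp add: simps)
  then have ri: "r \<cdot> TArr T i = Id C (TObj T A)"
    using monic_TArr by (simp add: monic_def hom_def simps)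
  have q: "\<alpha> \<cdot> TArr T i \<in> hom C (TObj T A) X" and p: "r \<cdot> t \<in> hom C X (TObj T A)"
    by (simp_all add: hom_def simps)
  \<comment> \<open>A left inverse of \<open>T i = t \<cdot> (\<alpha> \<cdot> T i)\<close>,
    composed with \<open>t\<close>, is a left inverse of the comparison.\<close>
  have pq: "r \<cdot> t \<cdot> (\<alpha> \<cdot> TArr T i) = Id C (TObj T A)"
  proof -
    have "r \<cdot> t \<cdot> (\<alpha> \<cdot> TArr T i) = r \<cdot> (t \<cdot> (\<alpha> \<cdot> TArr T i))"
      by (simp add: simps)
    then show ?thesis
      unfolding t_comparison ri .
  qed
  have "isomorphic (eilenberg_moore C T) (X, \<alpha>) (TObj T A, Mult T A)"
    using obj_if_hom(1)[OF i_in_hom]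
    by (intro algebra_isomorphicI[OF algebra algebra_free p q] comparison_algebra_hom pq
        iso_if_split_mono_epic[OF q p pq assms(2)])
  then show ?thesis
    using algebra obj_if_hom(1)[OF i_in_hom] by (auto simp: algebraic_def)
qed

lemma dense_epic_if_algebraic:
  assumes "algebraic C T (X, \<alpha>)"
  shows "T_dense C T i \<and> epic C (\<alpha> \<cdot> TArr T i)"
proof -
  obtain Y where Y: "Y \<in> Obj C"
    and iso: "isomorphic (eilenberg_moore C T) (X, \<alpha>) (TObj T Y, Mult T Y)"
    using assms by (auto simp: algebraic_def)
  obtain f g where f: "f \<in> hom C X (TObj T Y)" and g: "g \<in> hom C (TObj T Y) X"
    and gf: "g \<cdot> f = Id C X" and fg: "f \<cdot> g = Id C (TObj T Y)"
    and f_alg: "f \<cdot> \<alpha> = Mult T Y \<cdot> TArr T f" and g_alg: "g \<cdot> Mult T Y = \<alpha> \<cdot> TArr T g"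
    using iso by (rule algebra_isomorphicE)
  \<comment> \<open>The unit of \<open>Y\<close> carried along the isomorphism; \<open>g\<close> is
    then recovered as the homomorphic extension \<open>\<alpha> \<cdot> T u\<close>.\<close>
  define u where "u = g \<cdot> Unit T Y"
  have u: "u \<in> hom C Y X"
    unfolding u_def using Comp_in_hom Unit_in_hom[OF Y] g by blast
  note simps = split_simps Y arr_if_hom[OF f] arr_if_hom[OF g] arr_if_hom[OF u]
  have "\<alpha> \<cdot> TArr T u = \<alpha> \<cdot> TArr T g \<cdot> TArr T (Unit T Y)"
    by (simp add: u_def simps)
  then have \<alpha>_Tu: "\<alpha> \<cdot> TArr T u = g"
    unfolding g_alg[symmetric] by (simp add: simps Mult_TArr_Unit)
  \<comment> \<open>On the free algebra \<open>T e\<close> is left adjoint to \<open>m\<close>. Its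
    transport \<open>T g \<cdot> T e \<cdot> f = T u \<cdot> f\<close> is left adjoint to
    \<open>\<alpha>\<close>, hence equals \<open>t\<close>.\<close>
  have t_eq: "t = TArr T u \<cdot> f"
  proof (rule left_adjoint_unique[OF t_adjunction])
    have "\<alpha> \<cdot> (TArr T u \<cdot> f) = g \<cdot> f"
      unfolding \<alpha>_Tu[symmetric] by (simp add: simps)
    then have unit: "Id C X \<sqsubseteq> \<alpha> \<cdot> (TArr T u \<cdot> f)"
      using gf Le_refl[OF Id_in_hom[OF X_in_Obj]] by simp
    have "TArr T g \<cdot> (TArr T (Unit T Y) \<cdot> Mult T Y) \<sqsubseteq> TArr T g \<cdot> Id C (TObj T (TObj T Y))"
      by (rule Comp_mono_right[OF _ _ TArr_in_hom[OF g] TArr_Unit_Mult_le[OF Y]])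
        (simp_all add: hom_def simps)
    then have "TArr T g \<cdot> (TArr T (Unit T Y) \<cdot> Mult T Y) \<cdot> TArr T f \<sqsubseteq>
        TArr T g \<cdot> Id C (TObj T (TObj T Y)) \<cdot> TArr T f"
      by (intro Comp_mono_left[OF TArr_in_hom[OF f]]) (simp_all add: hom_def simps)
    moreover have "TArr T g \<cdot> Id C (TObj T (TObj T Y)) \<cdot> TArr T f = Id C (TObj T X)"
      using TArr_Comp[OF f g] gf by (simp add: simps TArr_Id)
    moreover have "TArr T g \<cdot> (TArr T (Unit T Y) \<cdot> Mult T Y) \<cdot> TArr T f = TArr T u \<cdot> f \<cdot> \<alpha>"
      using f_alg by (simp add: u_def simps)
    ultimately have "TArr T u \<cdot> f \<cdot> \<alpha> \<sqsubseteq> Id C (TObj T X)"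
      by simp
    with unit show "adjunction C X (TObj T X) (TArr T u \<cdot> f) \<alpha>"
      by (simp add: adjunction_def hom_def simps)
  qed
  \<comment> \<open>Once \<open>f \<cdot> g\<close> cancels, naturality of the unit at
    \<open>u\<close> shows that \<open>u\<close> equalises the pair and so factors through
    \<open>i\<close>.\<close>
  have "t \<cdot> u = TArr T u \<cdot> (f \<cdot> g) \<cdot> Unit T Y"
    by (subst t_eq, subst (2) u_def) (simp add: simps)
  then have "Unit T X \<cdot> u = t \<cdot> u"
    unfolding fg Unit_natural[OF u] by (simp add: simps)
  then obtain k where k: "k \<in> hom C Y A" and ik: "i \<cdot> k = u"
    using equaliser u unfolding equaliser_def by blast
  note simps = simps arr_if_hom[OF k]
  have Ti_Tk: "TArr T i \<cdot> TArr T k = TArr T u"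
    using ik by (simp add: TArr_Comp[OF k i_in_hom, symmetric])
  \<comment> \<open>The candidate inverse of the comparison \<open>q\<close>, chosen so that
    \<open>T i \<cdot> p = T u \<cdot> f = t\<close>.\<close>
  define p where "p = TArr T k \<cdot> f"
  define q where "q = \<alpha> \<cdot> TArr T i"
  have p: "p \<in> hom C X (TObj T A)" and q: "q \<in> hom C (TObj T A) X"
    by (simp_all add: hom_def simps p_def q_def)
  note simps' = simps arr_if_hom[OF p] arr_if_hom[OF q]
  have Ti_p: "TArr T i \<cdot> p = t"
    unfolding p_def t_eq Ti_Tk[symmetric] by (simp add: simps)
  have "q \<cdot> p = \<alpha> \<cdot> (TArr T i \<cdot> p)"
    unfolding q_def by (simp add: simps')
  also have "\<dots> = \<alpha> \<cdot> TArr T u \<cdot> f"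
    unfolding Ti_p t_eq by (simp add: simps)
  finally have qp: "q \<cdot> p = Id C X"
    unfolding \<alpha>_Tu gf .
  \<comment> \<open>Both sides of \<open>p \<cdot> q = id\<close> agree after composition with the
    monomorphism \<open>T i\<close>, by \<open>t_comparison\<close>.\<close>
  have "TArr T i \<cdot> (p \<cdot> q) = TArr T i \<cdot> p \<cdot> q"
    by (simp add: simps')
  also have "\<dots> = TArr T i \<cdot> Id C (TObj T A)"
    unfolding Ti_p q_def t_comparison by (simp add: simps)
  finally have pq: "p \<cdot> q = Id C (TObj T A)"
    using monic_TArr by (simp add: monic_def hom_def simps')
  \<comment> \<open>\<open>q\<close> extends \<open>i\<close> along the unit of \<open>A\<close>, so
    its inverse satisfies \<open>p \<cdot> i = e\<close>: the unit condition for density holds as an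
    equality.\<close>
  have "q \<cdot> Unit T A = \<alpha> \<cdot> (TArr T i \<cdot> Unit T A)"
    unfolding q_def by (simp add: simps)
  also have "\<dots> = \<alpha> \<cdot> Unit T X \<cdot> i"
    unfolding Unit_natural[OF i_in_hom, symmetric] by (simp add: simps)
  finally have q_Unit: "q \<cdot> Unit T A = i"
    unfolding \<alpha>_Unit by (simp add: simps)
  have "p \<cdot> i = p \<cdot> q \<cdot> Unit T A"
    unfolding q_Unit[symmetric] by (simp add: simps')
  then have "p \<cdot> i = Unit T A"
    unfolding pq by (simp add: simps)
  then have "Unit T A \<sqsubseteq> p \<cdot> i"
    using Le_refl[OF Unit_in_hom] obj_if_hom(1)[OF i_in_hom] by simp
  moreover have "TArr T i \<cdot> p \<sqsubseteq> Unit T X"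
    unfolding Ti_p by (rule t_le_Unit)
  ultimately have "T_dense C T i"
    using T_dense_iff[OF i_in_hom] p by blast
  moreover have "epic C q"
    using q p qp by (rule epic_if_right_inverse)
  ultimately show ?thesis
    by (simp add: q_def)
qed

end

theorem theorem3p18:
  fixes C :: "('o, 'a) ocat" and T :: "('o, 'a) monad_data"
    and X A :: 'o and \<alpha> t i :: 'a
  assumes "order_enriched_category C"
    and "has_equalisers C"
    and "kz_monad C T"
    and "\<And>j. regular_mono C j \<Longrightarrow> monic C (TArr T j)"
    and "split_algebra C T (X, \<alpha>)"
    and "adjunction C X (TObj T X) t \<alpha>"
    and "adjunction C (TObj T X) X \<alpha> (Unit T X)"
    and "equaliser C X (TObj T X) (Unit T X) t A i"
  shows "algebraic C T (X, \<alpha>) \<longleftrightarrow> T_dense C T i \<and> epic C (\<alpha> \<cdot>\<^bsub>C\<^esub> TArr T i)"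
proof -
  interpret kz_monad C T
    by fact
  interpret split_algebra_equaliser C T X A \<alpha> t i
  proof
    show "algebra C T (X, \<alpha>)"
      using assms(5) by (simp add: split_algebra_def)
    show "monic C (TArr T i)"
      using assms(4,8) unfolding regular_mono_def by blast
  qed fact+
  show ?thesis
    using algebraic_if_dense_epic dense_epic_if_algebraic by blast
qed

end
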